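(* Let $n,m\in\mathbb{N}$, let $f:\mathbb{R}^n\times\mathbb{R}^m\to\mathbb{R}^n$ and $r:\mathbb{R}^n\times\mathbb{R}^m\to\mathbb{R}$ be bounded and Lipschitz continuous, and let $\gamma>\|f\|_{\mathrm{Lip}(\mathbb{R}^n\times\mathbb{R}^m)}$. For $L>0$ let $Q^L$ be the value function, which is the viscosity solution of $$\gamma Q^L-D_xQ^L\cdot f(x,a)-L\|D_aQ^L\|_2-r(x,a)=0\quad\text{in }\mathbb{R}^n\times\mathbb{R}^m .$$ Then there exists a constant $C$, independent of $L$, $\ell$ and $(x,a)$, such that for all $L>0$, $\ell>0$ and $(x,a)\in\mathbb{R}^n\times\mathbb{R}^m$, $$0\le Q^{L+\ell}(x,a)-Q^L(x,a)\le\frac{C\ell}{L+\ell},$$ and hence $$\limsup_{\ell\to0}\frac{Q^{L+\ell}(x,a)-Q^L(x,a)}{\ell}\le\frac{C}{L}.$$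
   Context: $\|\cdot\|_2$ is the Euclidean norm, and $\|f\|_{\mathrm{Lip}(\mathbb{R}^n\times\mathbb{R}^m)}$ is the Lipschitz constant of $f$ with respect to Euclidean norms. For $L>0$, $\mathcal{A}^L$ is the set of functions $a(\cdot):[0,\infty)\to\mathbb{R}^m$ with $\|a(s_1)-a(s_2)\|_2\le L|s_1-s_2|$ for all $s_1,s_2\ge 0$. The value function is $$Q^L(x,a)=\sup_{a(\cdot)\in\mathcal{A}^L,\ a(0)=a}\int_0^\infty e^{-\gamma s}r(x(s),a(s))\,ds,$$ where $x'(s)=f(x(s),a(s))$ for $s>0$ and $x(0)=x$. It is known that $Q^L$ is a (bounded continuous) viscosity solution of the stated equation. In the last limit, $\ell\to0$ through positive values. *)

theory Defs
  imports "HOL-Analysis.Analysis"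
begin

definition lip_const :: "('a::metric_space \<Rightarrow> 'b::metric_space) \<Rightarrow> real" where
  "lip_const g = Inf {K. K-lipschitz_on UNIV g}"

text \<open>A control \<open>a : [0,\<infinity>) \<rightarrow> \<real>\<^sup>m\<close> is represented by a function on all of \<open>\<real>\<close>; its values
  at negative times are irrelevant here and below.\<close>

definition admissible_controls :: "real \<Rightarrow> (real \<Rightarrow> real ^ 'm) set" where
  "admissible_controls L = {\<alpha>. L-lipschitz_on {0..} \<alpha>}"

text \<open>The differential equation is imposed for \<open>s > 0\<close> only; continuity on \<open>[0,\<infinity>)\<close> is what ties the
  solution to its initial value.\<close>

definition is_trajectory ::
  "((real ^ 'n) \<times> (real ^ 'm) \<Rightarrow> real ^ 'n) \<Rightarrow> real ^ 'n \<Rightarrow> (real \<Rightarrow> real ^ 'm) \<Rightarrow> (real \<Rightarrow> real ^ 'n) \<Rightarrow> bool"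
where
  "is_trajectory f x \<alpha> \<xi> \<longleftrightarrow>
     \<xi> 0 = x \<and> continuous_on {0..} \<xi> \<and>
     (\<forall>s>0. (\<xi> has_vector_derivative f (\<xi> s, \<alpha> s)) (at s))"

definition payoff ::
  "((real ^ 'n) \<times> (real ^ 'm) \<Rightarrow> real) \<Rightarrow> real \<Rightarrow> (real \<Rightarrow> real ^ 'n) \<Rightarrow> (real \<Rightarrow> real ^ 'm) \<Rightarrow> real"
where
  "payoff r \<gamma> \<xi> \<alpha> = integral {0..} (\<lambda>s. exp (- \<gamma> * s) * r (\<xi> s, \<alpha> s))"

text \<open>For Lipschitz \<open>f\<close> each control determines exactly one trajectory on \<open>[0,\<infinity>)\<close>, so the supremum
  over pairs of a control and a trajectory is the supremum over controls.\<close>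

definition value_fun ::
  "((real ^ 'n) \<times> (real ^ 'm) \<Rightarrow> real ^ 'n) \<Rightarrow> ((real ^ 'n) \<times> (real ^ 'm) \<Rightarrow> real) \<Rightarrow> real \<Rightarrow> real
     \<Rightarrow> real ^ 'n \<Rightarrow> real ^ 'm \<Rightarrow> real"
where
  "value_fun f r \<gamma> L x a =
     Sup {payoff r \<gamma> \<xi> \<alpha> | \<xi> \<alpha>.
            \<alpha> \<in> admissible_controls L \<and> \<alpha> 0 = a \<and> is_trajectory f x \<alpha> \<xi>}"

end

theory Submission
  imports Defs
begin

text \<open>Given a control \<open>\<alpha>\<close> with Lipschitz constant \<open>L + l\<close>, slow it down: with \<open>c = L / (L + l)\<close> the
  control \<open>\<beta> s = \<alpha> (c * s)\<close> is \<open>L\<close>-Lipschitz. If \<open>\<xi>\<close> is the trajectory of \<open>\<alpha>\<close> and \<open>\<eta>\<close> that of \<open>\<beta>\<close>, then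
  \<open>z s = \<xi> (c * s)\<close> solves the equation of \<open>\<eta>\<close> up to an error of size \<open>(1 - c) * M\<close>, so Gronwall gives
  \<open>norm (\<eta> s - z s) \<le> (1 - c) * M / K * (exp (K * s) - 1)\<close>, which the discount \<open>\<gamma> > K\<close> absorbs. Rescaling
  time in the payoff of \<open>\<alpha>\<close> replaces the weight \<open>exp (- \<gamma> * s)\<close> by \<open>c * exp (- \<gamma> * c * s)\<close>, an
  \<open>L\<^sup>1\<close>-change of order \<open>1 - c\<close> as long as \<open>c \<ge> 1/2\<close>; for \<open>c < 1/2\<close> the claim is trivial since the
  payoffs are bounded by \<open>R / \<gamma>\<close>.\<close>

section \<open>Global solutions of Lipschitz differential equations on the half-line\<close>

text \<open>The Banach fixed point theorem is applied once, in an exponentially weighted sup norm,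
  so no local solutions have to be glued. The bound \<open>M\<close> makes every Picard image grow
  at most linearly, hence stay in the weighted space.\<close>

lemma exists_global_solution:
  fixes g :: "real \<Rightarrow> 'a::euclidean_space \<Rightarrow> 'a"
  assumes cont: "continuous_on ({0..} \<times> UNIV) (\<lambda>(t, u). g t u)"
    and lip: "\<And>t u v. 0 \<le> t \<Longrightarrow> norm (g t u - g t v) \<le> K * norm (u - v)"
    and bnd: "\<And>t u. 0 \<le> t \<Longrightarrow> norm (g t u) \<le> M"
    and K: "0 < K"
  obtains \<xi> where "\<xi> 0 = x" "continuous_on {0..} \<xi>"
    "\<And>s. 0 < s \<Longrightarrow> (\<xi> has_vector_derivative g s (\<xi> s)) (at s)"
proof -
  have cont_g: "continuous_on {0..} (\<lambda>s. g s (u s))" if "continuous_on {0..} u" for u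
    by (rule continuous_on_compose2[OF cont, of _ "\<lambda>s. (s, u s)", simplified])
      (auto intro!: continuous_intros that)
  text \<open>Writing the unknown as \<open>x + exp (2 * K * s) *\<^sub>R u s\<close> with bounded \<open>u\<close> makes the Picard map a
    contraction with constant \<open>1/2\<close> on the whole half-line. Time is truncated by \<open>max 0\<close> because
    the bounded continuous functions live on all of \<open>\<real>\<close>.\<close>
  define v where "v u s = g s (x + exp (2 * K * s) *\<^sub>R apply_bcontfun u s)" for u s
  have cont_v: "continuous_on {0..} (v u)" for u
    unfolding v_def by (rule cont_g) (auto intro!: continuous_intros)
  have int_v: "v u integrable_on {0..t}" for u t
    by (rule integrable_continuous_interval, rule continuous_on_subset[OF cont_v]) auto
  define I where "I u t = integral {0..t} (v u)" for u t
  have deriv_I: "(I u has_vector_derivative v u s) (at s)" if "0 < s" for u s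
  proof -
    have "continuous_on {0..s + 1} (v u)"
      by (rule continuous_on_subset[OF cont_v]) auto
    from integral_has_vector_derivative[OF this, of s] that
    have "(I u has_vector_derivative v u s) (at s within {0..s + 1})"
      by (simp add: I_def[abs_def])
    moreover have "at s within {0..s + 1} = at s"
      using that by (intro at_within_interior) auto
    ultimately show ?thesis by simp
  qed
  have cont_I: "continuous_on {0..} (I u)" for u
  proof -
    have "continuous (at s within {0..}) (I u)" if "0 \<le> s" for s
    proof -
      have "continuous_on {0..s + 1} (I u)"
        unfolding I_def[abs_def] by (rule indefinite_integral_continuous_1[OF int_v])
      with that have "continuous (at s within {0..s + 1}) (I u)"
        by (auto simp: continuous_on_eq_continuous_within)
      moreover have "at s within {0..s + 1} = at s within {0..}"
        by (rule at_within_nhd[of _ "{..<s + 1}"]) (use that in auto)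
      ultimately show ?thesis by simp
    qed
    then show ?thesis by (auto simp: continuous_on_eq_continuous_within)
  qed
  define F where "F u t = exp (- 2 * K * max 0 t) *\<^sub>R I u (max 0 t)" for u t
  have norm_I: "norm (I u t) \<le> M * t" if "0 \<le> t" for u t
  proof -
    have "norm (I u t) \<le> integral {0..t} (\<lambda>_. M)"
      unfolding I_def by (rule integral_norm_bound_integral[OF int_v]) (auto simp: v_def bnd)
    then show ?thesis using that by (simp add: mult.commute)
  qed
  have M: "0 \<le> M" using bnd[of 0 0] norm_ge_zero order_trans by blast
  have F_bnd: "norm (F u t) \<le> M / (2 * K)" for u t
  proof -
    define m where "m = max 0 t"
    have m: "0 \<le> m" by (simp add: m_def)
    \<comment> \<open>The weight beats the linear growth of \<open>I u\<close>: this is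
      \<open>y \<le> exp y\<close> at \<open>y = 2 * K * m\<close>, divided by
      \<open>2 * K * exp y\<close>.\<close>
    have "2 * K * m \<le> exp (2 * K * m)"
      using exp_ge_add_one_self[of "2 * K * m"] by linarith
    then have "exp (- 2 * K * m) * m \<le> 1 / (2 * K)"
      using K by (simp add: exp_minus field_simps)
    then have "M * (exp (- 2 * K * m) * m) \<le> M * (1 / (2 * K))"
      using M by (rule mult_left_mono)
    moreover have "norm (F u t) \<le> exp (- 2 * K * m) * (M * m)"
      using norm_I[OF m] by (simp add: F_def m_def[symmetric] mult_left_mono)
    ultimately show ?thesis by (simp add: algebra_simps)
  qed
  have F_bcont: "F u \<in> bcontfun" for u
  proof -
    have "continuous_on UNIV (\<lambda>t. I u (max 0 t))"
      by (rule continuous_on_compose2[OF cont_I]) (auto intro!: continuous_intros)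
    then have "continuous_on UNIV (F u)"
      unfolding F_def[abs_def] by (intro continuous_intros)
    moreover have "bounded (range (F u))"
      using F_bnd by (auto simp: bounded_iff)
    ultimately show ?thesis by (simp add: bcontfun_def)
  qed
  define T where "T u = Bcontfun (F u)" for u
  have T_apply: "apply_bcontfun (T u) = F u" for u
    by (simp add: T_def Bcontfun_inverse F_bcont)
  have contraction: "dist (T u) (T w) \<le> 1 / 2 * dist u w" for u w
  proof (rule dist_bound)
    fix t :: real
    define m where "m = max 0 t"
    define d where "d = dist u w"
    have m: "0 \<le> m" by (simp add: m_def)
    \<comment> \<open>The contraction constant 1/2 arises here: integrating a weight of rate
      \<open>2 * K\<close> gains the factor \<open>1 / (2 * K)\<close>, against a Lipschitz factor
      \<open>K\<close>.\<close>
    have "((\<lambda>s. K * d * exp (2 * K * s)) has_integral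
        (d / 2 * exp (2 * K * m) - d / 2 * exp (2 * K * 0))) {0..m}"
      using m K by (intro fundamental_theorem_of_calculus)
        (auto intro!: derivative_eq_intros
          simp flip: has_real_derivative_iff_has_vector_derivative)
    then have hi: "((\<lambda>s. K * d * exp (2 * K * s)) has_integral
        (d / 2 * (exp (2 * K * m) - 1))) {0..m}"
      by (simp add: algebra_simps)
    have pt: "norm (v u s - v w s) \<le> K * d * exp (2 * K * s)" if "s \<in> {0..m}" for s
    proof -
      have "norm (v u s - v w s) \<le> K * norm (exp (2 * K * s) *\<^sub>R (u s - w s))"
        using lip[of s "x + exp (2 * K * s) *\<^sub>R u s" "x + exp (2 * K * s) *\<^sub>R w s"] that
        by (simp add: v_def scaleR_diff_right)
      also have "\<dots> \<le> K * (exp (2 * K * s) * d)"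
        using K dist_bounded[of u s w] by (simp add: d_def dist_norm)
      finally show ?thesis by (simp add: algebra_simps)
    qed
    have "norm (I u m - I w m) = norm (integral {0..m} (\<lambda>s. v u s - v w s))"
      unfolding I_def by (simp add: integral_diff int_v)
    also have "\<dots> \<le> integral {0..m} (\<lambda>s. K * d * exp (2 * K * s))"
      by (rule integral_norm_bound_integral) (use hi pt int_v in \<open>auto intro!: integrable_diff\<close>)
    also have "\<dots> = d / 2 * (exp (2 * K * m) - 1)"
      using hi by (rule integral_unique)
    also have "\<dots> \<le> d / 2 * exp (2 * K * m)"
      by (rule mult_left_mono) (auto simp: d_def)
    finally have *: "norm (I u m - I w m) \<le> d / 2 * exp (2 * K * m)" .
    have "dist (T u t) (T w t) = exp (- 2 * K * m) * norm (I u m - I w m)"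
      by (simp add: T_apply F_def dist_norm m_def[symmetric] flip: scaleR_diff_right)
    also have "\<dots> \<le> exp (- 2 * K * m) * (d / 2 * exp (2 * K * m))"
      by (rule mult_left_mono[OF *]) simp
    also have "\<dots> = 1 / 2 * d"
      by (simp add: exp_minus field_simps)
    finally show "dist (T u t) (T w t) \<le> 1 / 2 * dist u w" by (simp add: d_def)
  qed
  have "\<exists>!u. T u = u"
    by (rule banach_fix_type[of "1/2"]) (use contraction in auto)
  then obtain u where u: "T u = u" by blast
  define \<xi> where "\<xi> t = x + I u t" for t
  \<comment> \<open>Undoing the weight in the fixed point equation shows that the argument of
    \<open>g\<close> inside \<open>v u\<close> is \<xi> itself, so the integrand of
    \<open>I u\<close> becomes the right-hand side of the equation.\<close>
  have "exp (2 * K * s) *\<^sub>R u s = I u s" if "0 \<le> s" for s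
  proof -
    have "u s = exp (- 2 * K * s) *\<^sub>R I u s"
      using T_apply[of u] that unfolding u by (simp add: F_def fun_eq_iff)
    then show ?thesis by (simp flip: exp_add)
  qed
  then have v_eq: "v u s = g s (\<xi> s)" if "0 \<le> s" for s
    using that by (simp add: v_def \<xi>_def)
  show thesis
  proof
    show "\<xi> 0 = x" by (simp add: \<xi>_def I_def)
    show "continuous_on {0..} \<xi>" unfolding \<xi>_def by (intro continuous_intros cont_I)
    show "(\<xi> has_vector_derivative g s (\<xi> s)) (at s)" if "0 < s" for s
      using deriv_I[OF that, of u] that v_eq[of s]
      by (auto simp: \<xi>_def[abs_def] intro!: derivative_eq_intros)
  qed
qed

section \<open>Gronwall inequality\<close>

text \<open>The norm of \<open>w\<close> may fail to be differentiable where \<open>w\<close>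
  vanishes, so it is replaced by the majorant \<open>U\<close>, the integral of
  \<open>K * norm (w s) + D\<close>. The mean value inequality gives
  \<open>norm (w s) \<le> U s\<close>, whence \<open>U\<close> satisfies the same differential
  inequality and is differentiable.\<close>

lemma norm_le_of_differential_inequality:
  fixes w :: "real \<Rightarrow> 'a::real_normed_vector"
  assumes cont: "continuous_on {0..} w" and w0: "w 0 = 0"
    and deriv: "\<And>s. 0 < s \<Longrightarrow> (w has_vector_derivative w' s) (at s)"
    and ineq: "\<And>s. 0 < s \<Longrightarrow> norm (w' s) \<le> K * norm (w s) + D"
    and K: "0 < K" and t: "0 \<le> t"
  shows "norm (w t) \<le> D / K * (exp (K * t) - 1)"
proof (cases "t = 0")
  case False
  with t have t: "0 < t" by simp
  define h where "h s = K * norm (w s) + D" for s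
  have cont_h: "continuous_on {0..a} h" for a
    unfolding h_def[abs_def] by (intro continuous_intros continuous_on_subset[OF cont]) auto
  define U where "U a = integral {0..a} h" for a
  have cont_U: "continuous_on {0..a} U" for a
    unfolding U_def[abs_def]
    by (rule indefinite_integral_continuous_1[OF integrable_continuous_interval[OF cont_h]])
  have deriv_U: "(U has_real_derivative h s) (at s)" if "0 < s" for s
  proof -
    from integral_has_vector_derivative[OF cont_h[of "s + 1"], of s] that
    have "(U has_vector_derivative h s) (at s within {0..s + 1})"
      by (simp add: U_def[abs_def])
    moreover have "at s within {0..s + 1} = at s"
      using that by (intro at_within_interior) auto
    ultimately show ?thesis by (simp add: has_real_derivative_iff_has_vector_derivative)
  qed
  have U0: "U 0 = 0" by (simp add: U_def)
  have w_le: "norm (w a) \<le> U a" if "0 < a" for a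
  proof -
    have "norm (w a - w 0) \<le> U a - U 0"
    proof (rule differentiable_bound_general[OF that _ cont_U])
      show "continuous_on {0..a} w" by (rule continuous_on_subset[OF cont]) auto
      show "(w has_vector_derivative w' s) (at s)" if "0 < s" for s using deriv that .
      show "(U has_vector_derivative h s) (at s)" if "0 < s" for s
        using deriv_U[OF that] by (simp add: has_real_derivative_iff_has_vector_derivative)
      show "norm (w' s) \<le> h s" if "0 < s" for s
        using ineq[OF that] by (simp add: h_def)
    qed
    then show ?thesis by (simp add: w0 U0)
  qed
  \<comment> \<open>Integrating factor for \<open>U' \<le> K * U + D\<close>: the shift by
    \<open>D / K\<close> absorbs the inhomogeneity, so \<open>V\<close> is nonincreasing.\<close>
  define V where "V a = (U a + D / K) * exp (- K * a)" for a
  have "V t \<le> V 0"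
  proof (rule DERIV_nonpos_imp_decreasing_open[of 0 t V])
    show "continuous_on {0..t} V"
      unfolding V_def[abs_def] by (intro continuous_intros cont_U)
    fix s assume s: "0 < s" "s < t"
    have "(V has_real_derivative (h s - K * U s - D) * exp (- K * s)) (at s)"
      unfolding V_def[abs_def] using K
      by (auto intro!: derivative_eq_intros deriv_U[OF s(1)] simp: field_simps)
    moreover have "h s - K * U s - D \<le> 0"
      using w_le[OF s(1)] K by (simp add: h_def)
    then have "(h s - K * U s - D) * exp (- K * s) \<le> 0"
      by (simp add: mult_nonpos_nonneg)
    ultimately show "\<exists>y. (V has_real_derivative y) (at s) \<and> y \<le> 0" by blast
  qed (use t in simp)
  then have "(U t + D / K) * exp (- K * t) * exp (K * t) \<le> D / K * exp (K * t)"
    by (intro mult_right_mono) (auto simp: V_def U0)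
  then have "U t + D / K \<le> D / K * exp (K * t)"
    by (simp add: mult.assoc flip: exp_add)
  with w_le[OF t] show ?thesis by (simp add: algebra_simps)
qed (simp add: w0)

text \<open>Ensures that the supremum in the value function runs over a nonempty set and that a
  slowed-down control has a trajectory to compare with.\<close>

lemma exists_trajectory:
  fixes f :: "(real ^ 'n) \<times> (real ^ 'm) \<Rightarrow> real ^ 'n"
  assumes lip: "K-lipschitz_on UNIV f" and K: "0 < K" and bnd: "\<And>p. norm (f p) \<le> M"
    and cont: "continuous_on {0..} \<alpha>"
  obtains \<xi> where "is_trajectory f x \<alpha> \<xi>"
proof -
  have cont_f: "continuous_on UNIV f"
    using lip by (rule lipschitz_on_continuous_on)
  have c: "continuous_on ({0..} \<times> UNIV) (\<lambda>(t, u). f (u, \<alpha> t))"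
    unfolding case_prod_beta
    by (intro continuous_on_compose2[OF cont_f] continuous_intros
        continuous_on_compose2[OF cont]) auto
  have l: "norm (f (u, \<alpha> t) - f (v, \<alpha> t)) \<le> K * norm (u - v)" for t u v
    using lipschitz_onD[OF lip, of "(u, \<alpha> t)" "(v, \<alpha> t)"]
    by (simp add: dist_Pair_Pair dist_norm)
  obtain \<xi> where "\<xi> 0 = x" "continuous_on {0..} \<xi>"
    "\<And>s. 0 < s \<Longrightarrow> (\<xi> has_vector_derivative f (\<xi> s, \<alpha> s)) (at s)"
    using exists_global_solution[of "\<lambda>t u. f (u, \<alpha> t)" K M x, OF c l bnd K] by blast
  then show thesis using that by (auto simp: is_trajectory_def)
qed

section \<open>Discounted payoffs and change of time scale\<close>

text \<open>Domination by \<open>exp (- g * s) * R\<close>, whose integral is \<open>R / g\<close>.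
  Absolute integrability is what the change of variables requires; the bound makes all payoffs
  uniformly bounded.\<close>

lemma discounted_integral:
  fixes h :: "real \<Rightarrow> real"
  assumes cont: "continuous_on {0..} h" and bnd: "\<And>s. 0 \<le> s \<Longrightarrow> \<bar>h s\<bar> \<le> R" and g: "0 < g"
  shows "(\<lambda>s. exp (- g * s) * h s) absolutely_integrable_on {0..}"
    and "\<bar>integral {0..} (\<lambda>s. exp (- g * s) * h s)\<bar> \<le> R / g"
proof -
  have e: "((\<lambda>s. exp (- g * s) * R) has_integral R / g) {0..}"
    using has_integral_mult_left[OF has_integral_exp_minus_to_infinity[OF g, of 0], of R] by simp
  have le: "norm (exp (- g * s) * h s) \<le> exp (- g * s) * R" if "s \<in> {0..}" for s
    using bnd[of s] that by (simp add: abs_mult)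
  have meas: "(\<lambda>s. exp (- g * s) * h s) \<in> borel_measurable (lebesgue_on {0..})"
    by (intro continuous_imp_measurable_on_sets_lebesgue continuous_intros cont) auto
  show ai: "(\<lambda>s. exp (- g * s) * h s) absolutely_integrable_on {0..}"
    by (rule measurable_bounded_by_integrable_imp_absolutely_integrable[OF meas])
      (use e le in auto)
  have "norm (integral {0..} (\<lambda>s. exp (- g * s) * h s)) \<le> integral {0..} (\<lambda>s. exp (- g * s) * R)"
    by (rule integral_norm_bound_integral)
      (use ai e le in \<open>auto simp: absolutely_integrable_on_def\<close>)
  then show "\<bar>integral {0..} (\<lambda>s. exp (- g * s) * h s)\<bar> \<le> R / g"
    unfolding integral_unique[OF e] by simp
qed

lemma continuous_on_along_trajectory:
  assumes "continuous_on UNIV r" "is_trajectory f x \<alpha> \<xi>" "continuous_on {0..} \<alpha>"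
  shows "continuous_on {0..} (\<lambda>s. r (\<xi> s, \<alpha> s))"
  using assms unfolding is_trajectory_def
  by (intro continuous_on_compose2[OF assms(1)] continuous_intros) auto

text \<open>Substituting \<open>c * s\<close> for the time variable puts the payoff of \<alpha> on
  the clock of the slowed-down control, so that the two payoffs can be compared under one integral.
  The case \<open>c = 1\<close> records that the payoff integral converges.\<close>

lemma payoff_rescale:
  fixes \<xi> :: "real \<Rightarrow> real ^ 'n" and \<alpha> :: "real \<Rightarrow> real ^ 'm"
  assumes cont: "continuous_on {0..} (\<lambda>s. r (\<xi> s, \<alpha> s))"
    and bnd: "\<And>p. \<bar>r p\<bar> \<le> R" and g: "0 < \<gamma>" and c: "0 < c"
  shows "((\<lambda>s. c * (exp (- \<gamma> * (c * s)) * r (\<xi> (c * s), \<alpha> (c * s))))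
    has_integral payoff r \<gamma> \<xi> \<alpha>) {0..}"
proof -
  let ?F = "\<lambda>s. exp (- \<gamma> * s) * r (\<xi> s, \<alpha> s)"
  have img: "(\<lambda>s. c * s) ` {0..} = {0..}"
  proof -
    have "y \<in> (\<lambda>s. c * s) ` {0..}" if "0 \<le> y" for y
      using that c by (intro image_eqI[of _ _ "y / c"]) auto
    then show ?thesis using c by auto
  qed
  have "(\<lambda>s. \<bar>c\<bar> * ?F (c * s)) absolutely_integrable_on {0..} \<and>
      integral {0..} (\<lambda>s. \<bar>c\<bar> * ?F (c * s)) = payoff r \<gamma> \<xi> \<alpha>
    \<longleftrightarrow> ?F absolutely_integrable_on (\<lambda>s. c * s) ` {0..} \<and>
      integral ((\<lambda>s. c * s) ` {0..}) ?F = payoff r \<gamma> \<xi> \<alpha>"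
    by (rule has_absolute_integral_change_of_variables_1')
      (use c in \<open>auto intro!: derivative_eq_intros inj_onI\<close>)
  moreover have "?F absolutely_integrable_on {0..}"
    using discounted_integral(1)[OF cont bnd g] .
  ultimately show ?thesis
    using c by (simp add: img payoff_def has_integral_iff absolutely_integrable_on_def)
qed

section \<open>Payoff lost by slowing down a control\<close>

text \<open>On the common clock the difference of the integrands splits into the change of the
  discount weight, paid for by the bound \<open>R\<close>, and the deviation of the trajectories,
  paid for by the Lipschitz constant \<rho>. These give the two summands of the constant.\<close>

lemma payoff_slow_down:
  fixes f :: "(real ^ 'n) \<times> (real ^ 'm) \<Rightarrow> real ^ 'n"
  assumes lip_f: "K-lipschitz_on UNIV f" and K: "0 < K" "K < \<gamma>"
    and bnd_f: "\<And>p. norm (f p) \<le> M"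
    and lip_r: "\<rho>-lipschitz_on UNIV r" and bnd_r: "\<And>p. \<bar>r p\<bar> \<le> R"
    and c: "1 / 2 \<le> c" "c \<le> 1"
    and cont: "continuous_on {0..} \<alpha>"
    and \<xi>: "is_trajectory f x \<alpha> \<xi>" and \<eta>: "is_trajectory f x (\<lambda>s. \<alpha> (c * s)) \<eta>"
  shows "payoff r \<gamma> \<xi> \<alpha> - payoff r \<gamma> \<eta> (\<lambda>s. \<alpha> (c * s))
    \<le> (4 * R / \<gamma> + \<rho> * M / (K * (\<gamma> - K))) * (1 - c)"
proof -
  have g: "0 < \<gamma>" and c0: "0 < c" using K c by auto
  have \<rho>: "0 \<le> \<rho>" using lip_r by (rule lipschitz_on_nonneg)
  have M: "0 \<le> M" using bnd_f[of 0] norm_ge_zero order_trans by blast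
  have R: "0 \<le> R" using bnd_r[of 0] by linarith
  have cont_r: "continuous_on UNIV r"
    using lip_r by (rule lipschitz_on_continuous_on)
  define \<beta> where "\<beta> s = \<alpha> (c * s)" for s
  define z where "z s = \<xi> (c * s)" for s
  have cont_\<beta>: "continuous_on {0..} \<beta>"
    unfolding \<beta>_def using c0
    by (intro continuous_on_compose2[OF cont] continuous_intros) auto
  have cont_\<xi>: "continuous_on {0..} \<xi>" using \<xi> by (simp add: is_trajectory_def)
  have cont_z: "continuous_on {0..} z"
    unfolding z_def using c0
    by (intro continuous_on_compose2[OF cont_\<xi>] continuous_intros) auto
  have \<eta>': "is_trajectory f x \<beta> \<eta>" using \<eta> by (simp add: \<beta>_def[abs_def])
  have deriv_z: "(z has_vector_derivative c *\<^sub>R f (z s, \<beta> s)) (at s)" if "0 < s" for s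
  proof -
    have "(\<xi> has_vector_derivative f (z s, \<beta> s)) (at (c * s))"
      using \<xi> that c0 by (simp add: is_trajectory_def z_def \<beta>_def)
    moreover have "((\<lambda>s. c * s) has_vector_derivative c) (at s)"
      by (auto intro!: derivative_eq_intros simp flip: has_real_derivative_iff_has_vector_derivative)
    ultimately have "(\<xi> \<circ> (\<lambda>s. c * s) has_vector_derivative c *\<^sub>R f (z s, \<beta> s)) (at s)"
      by (intro vector_diff_chain_at)
    then show ?thesis by (simp add: o_def z_def[abs_def])
  qed
  have close: "norm (\<eta> s - z s) \<le> (1 - c) * M / K * (exp (K * s) - 1)" if "0 \<le> s" for s
  proof (rule norm_le_of_differential_inequality[OF _ _ _ _ K(1) that])
    show "continuous_on {0..} (\<lambda>s. \<eta> s - z s)"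
      using \<eta>' by (intro continuous_intros cont_z) (simp add: is_trajectory_def)
    show "\<eta> 0 - z 0 = 0" using \<eta>' \<xi> by (simp add: is_trajectory_def z_def)
    fix s :: real assume s: "0 < s"
    show "((\<lambda>s. \<eta> s - z s) has_vector_derivative f (\<eta> s, \<beta> s) - c *\<^sub>R f (z s, \<beta> s)) (at s)"
      using \<eta>' s by (intro derivative_intros deriv_z) (auto simp: is_trajectory_def)
    have "f (\<eta> s, \<beta> s) - c *\<^sub>R f (z s, \<beta> s)
        = (f (\<eta> s, \<beta> s) - f (z s, \<beta> s)) + (1 - c) *\<^sub>R f (z s, \<beta> s)"
      by (simp add: algebra_simps)
    also have "norm \<dots> \<le> norm (f (\<eta> s, \<beta> s) - f (z s, \<beta> s)) + norm ((1 - c) *\<^sub>R f (z s, \<beta> s))"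
      by (rule norm_triangle_ineq)
    also have "norm (f (\<eta> s, \<beta> s) - f (z s, \<beta> s)) \<le> K * norm (\<eta> s - z s)"
      using lipschitz_onD[OF lip_f, of "(\<eta> s, \<beta> s)" "(z s, \<beta> s)"]
      by (simp add: dist_Pair_Pair dist_norm)
    also have "norm ((1 - c) *\<^sub>R f (z s, \<beta> s)) \<le> (1 - c) * M"
      using c bnd_f by (simp add: mult_left_mono)
    finally show "norm (f (\<eta> s, \<beta> s) - c *\<^sub>R f (z s, \<beta> s)) \<le> K * norm (\<eta> s - z s) + (1 - c) * M"
      by simp
  qed
  define A where "A s = c * (exp (- \<gamma> * (c * s)) * r (z s, \<beta> s))" for s
  define B where "B s = exp (- \<gamma> * s) * r (\<eta> s, \<beta> s)" for s
  have A: "(A has_integral payoff r \<gamma> \<xi> \<alpha>) {0..}"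
    using payoff_rescale[OF continuous_on_along_trajectory[OF cont_r \<xi> cont] bnd_r g c0]
    by (simp add: A_def[abs_def] z_def \<beta>_def)
  have B: "(B has_integral payoff r \<gamma> \<eta> \<beta>) {0..}"
    using payoff_rescale[OF continuous_on_along_trajectory[OF cont_r \<eta>' cont_\<beta>] bnd_r g, of 1]
    by (simp add: B_def[abs_def])
  \<comment> \<open>An explicit majorant of \<open>A - B\<close> built from pure exponentials. The
    first line bounds the weight change without an absolute value; the second is the discounted
    Gronwall bound, integrable because \<open>K < \<gamma>\<close>.\<close>
  define G where "G s = R * ((2 - c) * exp (- (c * \<gamma>) * s) - exp (- \<gamma> * s))
    + \<rho> * ((1 - c) * M / K) * exp (- (\<gamma> - K) * s)" for s
  have e: "((\<lambda>s. exp (- a * s)) has_integral 1 / a) {0..}" if "0 < a" for a :: real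
    using has_integral_exp_minus_to_infinity[OF that, of 0] by simp
  have G: "(G has_integral R * ((2 - c) * (1 / (c * \<gamma>)) - 1 / \<gamma>)
      + \<rho> * ((1 - c) * M / K) * (1 / (\<gamma> - K))) {0..}"
    unfolding G_def[abs_def] using g c0 K
    by (intro has_integral_add has_integral_diff has_integral_mult_right e) auto
  have le: "A s - B s \<le> G s" if s: "0 \<le> s" for s
  proof -
    define p where "p = exp (- (c * \<gamma>) * s)"
    define q where "q = exp (- \<gamma> * s)"
    have "c * (\<gamma> * s) \<le> 1 * (\<gamma> * s)"
      using c g s by (intro mult_right_mono) auto
    then have qp: "q \<le> p" by (simp add: p_def q_def algebra_simps)
    have p: "0 \<le> p" and q: "0 \<le> q" by (simp_all add: p_def q_def)
    \<comment> \<open>\<open>c * p - q\<close> is the difference of the nonnegative quantities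
      \<open>p - q\<close> and \<open>(1 - c) * p\<close>, so its modulus is at most their
      sum.\<close>
    have "\<bar>c * p - q\<bar> \<le> (2 - c) * p - q"
      using mult_right_mono[OF c(2) p] qp by (simp add: algebra_simps abs_le_iff)
    moreover from this have "0 \<le> (2 - c) * p - q" using abs_ge_zero order_trans by blast
    ultimately have "\<bar>c * p - q\<bar> * \<bar>r (z s, \<beta> s)\<bar> \<le> ((2 - c) * p - q) * R"
      using bnd_r by (intro mult_mono) auto
    then have 1: "(c * p - q) * r (z s, \<beta> s) \<le> ((2 - c) * p - q) * R"
      using abs_ge_self[of "(c * p - q) * r (z s, \<beta> s)"] by (simp add: abs_mult)
    have "r (z s, \<beta> s) - r (\<eta> s, \<beta> s) \<le> \<rho> * norm (\<eta> s - z s)"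
      using lipschitz_onD[OF lip_r, of "(z s, \<beta> s)" "(\<eta> s, \<beta> s)"]
      by (simp add: dist_Pair_Pair dist_norm norm_minus_commute)
    \<comment> \<open>The \<open>- 1\<close> of the Gronwall bound is given away, so that
      multiplication by \<open>q\<close> leaves a single exponential.\<close>
    also have "\<dots> \<le> \<rho> * ((1 - c) * M / K * exp (K * s))"
    proof (rule mult_left_mono[OF order_trans[OF close[OF s]] \<rho>])
      show "(1 - c) * M / K * (exp (K * s) - 1) \<le> (1 - c) * M / K * exp (K * s)"
        using c M K by (intro mult_left_mono) auto
    qed
    finally have "q * (r (z s, \<beta> s) - r (\<eta> s, \<beta> s)) \<le> q * (\<rho> * ((1 - c) * M / K * exp (K * s)))"
      using q by (rule mult_left_mono)
    also have "\<dots> = \<rho> * ((1 - c) * M / K) * exp (- (\<gamma> - K) * s)"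
      by (simp add: q_def left_diff_distrib exp_diff exp_minus field_simps flip: exp_add)
    finally have "q * (r (z s, \<beta> s) - r (\<eta> s, \<beta> s)) \<le> \<rho> * ((1 - c) * M / K) * exp (- (\<gamma> - K) * s)" .
    with 1 have "(c * p - q) * r (z s, \<beta> s) + q * (r (z s, \<beta> s) - r (\<eta> s, \<beta> s))
        \<le> R * ((2 - c) * p - q) + \<rho> * ((1 - c) * M / K) * exp (- (\<gamma> - K) * s)"
      by (simp add: mult.commute)
    also have "(c * p - q) * r (z s, \<beta> s) + q * (r (z s, \<beta> s) - r (\<eta> s, \<beta> s)) = A s - B s"
      by (simp add: A_def B_def p_def q_def algebra_simps)
    finally show ?thesis by (simp add: G_def p_def q_def)
  qed
  have "payoff r \<gamma> \<xi> \<alpha> - payoff r \<gamma> \<eta> \<beta>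
      \<le> R * ((2 - c) * (1 / (c * \<gamma>)) - 1 / \<gamma>) + \<rho> * ((1 - c) * M / K) * (1 / (\<gamma> - K))"
    by (rule has_integral_le[OF has_integral_diff[OF A B] G]) (use le in auto)
  also have "(2 - c) * (1 / (c * \<gamma>)) - 1 / \<gamma> = 2 * (1 - c) / \<gamma> * (1 / c)"
    using c0 g by (simp add: field_simps)
  \<comment> \<open>Here \<open>1 / 2 \<le> c\<close> enters through \<open>1 / c \<le> 2\<close>,
    which produces the factor 4 in \<open>4 * R / \<gamma>\<close>.\<close>
  also have "R * \<dots> \<le> R * (2 * (1 - c) / \<gamma> * 2)"
    using c c0 g by (intro mult_left_mono R) (auto simp: field_simps)
  finally show ?thesis
    by (simp add: \<beta>_def[abs_def] algebra_simps add_divide_distrib diff_divide_distrib)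
qed

section \<open>The estimate for the value function\<close>

theorem lemma3p2:
  fixes f :: "(real ^ 'n) \<times> (real ^ 'm) \<Rightarrow> real ^ 'n"
    and r :: "(real ^ 'n) \<times> (real ^ 'm) \<Rightarrow> real"
    and \<gamma> :: real
  assumes "bounded (range f)" and "\<exists>K. K-lipschitz_on UNIV f"
    and "bounded (range r)" and "\<exists>K. K-lipschitz_on UNIV r"
    and "\<gamma> > lip_const f"
  shows "\<exists>C::real.
    (\<forall>L>0. \<forall>l>0. \<forall>x a.
       0 \<le> value_fun f r \<gamma> (L + l) x a - value_fun f r \<gamma> L x a \<and>
       value_fun f r \<gamma> (L + l) x a - value_fun f r \<gamma> L x a \<le> C * l / (L + l)) \<and>
    (\<forall>L>0. \<forall>x a.
       Limsup (at_right 0)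
         (\<lambda>l. ereal ((value_fun f r \<gamma> (L + l) x a - value_fun f r \<gamma> L x a) / l))
       \<le> ereal (C / L))"
proof -
  obtain M where M: "\<And>p. norm (f p) \<le> M"
    using assms(1) by (auto simp: bounded_iff)
  obtain R where R: "\<And>p. \<bar>r p\<bar> \<le> R"
    using assms(3) by (auto simp: bounded_iff)
  obtain \<rho> where \<rho>: "\<rho>-lipschitz_on UNIV r" using assms(4) by blast
  obtain K\<^sub>0 where K\<^sub>0: "K\<^sub>0-lipschitz_on UNIV f" "K\<^sub>0 < \<gamma>"
    using cInf_lessD[of "{K. K-lipschitz_on UNIV f}" \<gamma>] assms(2,5) by (auto simp: lip_const_def)
  \<comment> \<open>\<open>K\<^sub>0\<close> may be 0 when \<open>f\<close> is constant; enlarging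
    it strictly, still below \<gamma>, makes both \<open>K\<close> and \<open>\<gamma> - K\<close>
    positive denominators.\<close>
  obtain K where K: "K\<^sub>0 < K" "K < \<gamma>" using dense[OF K\<^sub>0(2)] by blast
  have lip_f: "K-lipschitz_on UNIV f"
    by (rule lipschitz_on_le[OF K\<^sub>0(1)]) (use K in simp)
  have K0: "0 < K" using lipschitz_on_nonneg[OF K\<^sub>0(1)] K by simp
  have g: "0 < \<gamma>" using K0 K by simp
  have R0: "0 \<le> R" using R[of 0] by linarith
  have M0: "0 \<le> M" using M[of 0] norm_ge_zero order_trans by blast
  have \<rho>0: "0 \<le> \<rho>" using \<rho> by (rule lipschitz_on_nonneg)
  have cont_r: "continuous_on UNIV r" using \<rho> by (rule lipschitz_on_continuous_on)
  \<comment> \<open>Only \<gamma> and constants chosen for \<open>f\<close> and \<open>r\<close>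
    occur, so \<open>C\<close> is independent of \<open>L\<close>, \<open>l\<close>,
    \<open>x\<close> and \<open>a\<close>.\<close>
  define C where "C = 4 * R / \<gamma> + \<rho> * M / (K * (\<gamma> - K))"
  have C: "4 * R / \<gamma> \<le> C" "0 \<le> C"
    using R0 M0 \<rho>0 K0 K g by (simp_all add: C_def)
  define P where "P L x a = {payoff r \<gamma> \<xi> \<alpha> | \<xi> \<alpha>.
    \<alpha> \<in> admissible_controls L \<and> \<alpha> 0 = a \<and> is_trajectory f x \<alpha> \<xi>}" for L x a
  have value_eq: "value_fun f r \<gamma> L x a = Sup (P L x a)" for L x a
    by (simp add: value_fun_def P_def)
  have cont_adm: "continuous_on {0..} \<alpha>" if "\<alpha> \<in> admissible_controls L"
    for L and \<alpha> :: "real \<Rightarrow> real ^ 'm"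
    using that lipschitz_on_continuous_on by (auto simp: admissible_controls_def)
  have P_bnd: "\<bar>p\<bar> \<le> R / \<gamma>" if "p \<in> P L x a" for p L x a
  proof -
    from that obtain \<xi> \<alpha> where p: "p = payoff r \<gamma> \<xi> \<alpha>"
      and \<alpha>: "\<alpha> \<in> admissible_controls L" and \<xi>: "is_trajectory f x \<alpha> \<xi>"
      by (auto simp: P_def)
    show ?thesis unfolding p payoff_def
      by (rule discounted_integral(2)[OF continuous_on_along_trajectory[OF cont_r \<xi> cont_adm[OF \<alpha>]] R g])
  qed
  have P_bdd: "bdd_above (P L x a)" for L x a
    using P_bnd[of _ L x a] by (intro bdd_aboveI[of _ "R / \<gamma>"]) (auto simp: abs_le_iff)
  have P_ne: "P L x a \<noteq> {}" if "0 < L" for L x a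
  proof -
    obtain \<xi> where "is_trajectory f x (\<lambda>_. a) \<xi>"
      by (rule exists_trajectory[OF lip_f K0 M, of "\<lambda>_. a"]) auto
    then have "payoff r \<gamma> \<xi> (\<lambda>_. a) \<in> P L x a"
      using that by (auto simp: P_def admissible_controls_def intro!: lipschitz_onI exI[of _ "\<lambda>_. a"])
    then show ?thesis by blast
  qed
  have mono: "value_fun f r \<gamma> L x a \<le> value_fun f r \<gamma> (L + l) x a" if "0 < L" "0 < l" for L l x a
    unfolding value_eq
  proof (rule cSup_subset_mono[OF P_ne[OF that(1)] P_bdd])
    have "admissible_controls L \<subseteq> (admissible_controls (L + l) :: (real \<Rightarrow> real ^ 'm) set)"
      unfolding admissible_controls_def using that by (auto intro: lipschitz_on_le)
    then show "P L x a \<subseteq> P (L + l) x a"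
      unfolding P_def by blast
  qed
  have upper: "value_fun f r \<gamma> (L + l) x a - value_fun f r \<gamma> L x a \<le> C * l / (L + l)"
    if L: "0 < L" and l: "0 < l" for L l x a
  \<comment> \<open>With \<open>c = L / (L + l)\<close>, \<open>l \<le> L\<close> means
    \<open>1 / 2 \<le> c\<close>, and \<open>1 - c\<close> is exactly the ratio
    \<open>l / (L + l)\<close> of the claim.\<close>
  proof (cases "l \<le> L")
    case True
    define c where "c = L / (L + l)"
    have c: "1 / 2 \<le> c" "c \<le> 1" "0 < c" and c1: "1 - c = l / (L + l)" and cL: "c * (L + l) = L"
      using L l True by (auto simp: c_def field_simps)
    have "p \<le> value_fun f r \<gamma> L x a + C * l / (L + l)" if "p \<in> P (L + l) x a" for p
    proof -
      from that obtain \<xi> \<alpha> where p: "p = payoff r \<gamma> \<xi> \<alpha>"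
        and \<alpha>: "\<alpha> \<in> admissible_controls (L + l)" and a: "\<alpha> 0 = a"
        and \<xi>: "is_trajectory f x \<alpha> \<xi>"
        by (auto simp: P_def)
      have lip_\<beta>: "L-lipschitz_on {0..} (\<lambda>s. \<alpha> (c * s))"
      proof (rule lipschitz_onI)
        fix s t :: real assume "s \<in> {0..}" "t \<in> {0..}"
        then have "dist (\<alpha> (c * s)) (\<alpha> (c * t)) \<le> (L + l) * dist (c * s) (c * t)"
          using \<alpha> c by (intro lipschitz_onD[of "L + l" "{0..}" \<alpha>]) (auto simp: admissible_controls_def)
        also have "dist (c * s) (c * t) = c * dist s t"
          using c by (simp add: dist_real_def abs_mult flip: right_diff_distrib)
        also have "(L + l) * (c * dist s t) = L * dist s t"
          using cL by (metis mult.assoc mult.commute)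
        finally show "dist (\<alpha> (c * s)) (\<alpha> (c * t)) \<le> L * dist s t" .
      qed (use L in simp)
      then have \<beta>: "(\<lambda>s. \<alpha> (c * s)) \<in> admissible_controls L"
        by (simp add: admissible_controls_def)
      obtain \<eta> where \<eta>: "is_trajectory f x (\<lambda>s. \<alpha> (c * s)) \<eta>"
        by (rule exists_trajectory[OF lip_f K0 M cont_adm[OF \<beta>]])
      \<comment> \<open>Scaling fixes time 0, so the slowed-down control still starts at
        \<open>a\<close>.\<close>
      have "payoff r \<gamma> \<eta> (\<lambda>s. \<alpha> (c * s)) \<in> P L x a"
        unfolding P_def using \<beta> \<eta> a by fastforce
      then have "payoff r \<gamma> \<eta> (\<lambda>s. \<alpha> (c * s)) \<le> value_fun f r \<gamma> L x a"
        unfolding value_eq by (rule cSup_upper[OF _ P_bdd])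
      moreover have "p - payoff r \<gamma> \<eta> (\<lambda>s. \<alpha> (c * s)) \<le> C * (1 - c)"
        unfolding p C_def
        by (rule payoff_slow_down[OF lip_f K0 K(2) M \<rho> R c(1,2) cont_adm[OF \<alpha>] \<xi> \<eta>])
      ultimately show ?thesis by (simp add: c1)
    qed
    then have "value_fun f r \<gamma> (L + l) x a \<le> value_fun f r \<gamma> L x a + C * l / (L + l)"
      unfolding value_eq[of "L + l"] using P_ne[of "L + l"] L l by (intro cSup_least) auto
    then show ?thesis by simp
  next
    case False
    obtain p where p: "p \<in> P L x a" using P_ne[OF L] by blast
    have "- (R / \<gamma>) \<le> p" using P_bnd[OF p] by (simp add: abs_le_iff)
    also have "p \<le> value_fun f r \<gamma> L x a" unfolding value_eq by (rule cSup_upper[OF p P_bdd])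
    finally have lo: "- (R / \<gamma>) \<le> value_fun f r \<gamma> L x a" .
    have hi: "value_fun f r \<gamma> (L + l) x a \<le> R / \<gamma>"
      unfolding value_eq using P_ne[of "L + l"] P_bnd[of _ "L + l"] L l
      by (intro cSup_least) (auto simp: abs_le_iff)
    \<comment> \<open>All payoffs lie within \<open>R / \<gamma>\<close> of 0, so two values differ
      by at most \<open>2 * (R / \<gamma>)\<close>; for \<open>l > L\<close> the ratio
      \<open>l / (L + l)\<close> exceeds 1/2, and \<open>4 * R / \<gamma> \<le> C\<close>
      suffices.\<close>
    have "2 * (R / \<gamma>) = 4 * R / \<gamma> * (1 / 2)" by simp
    also have "\<dots> \<le> C * (l / (L + l))"
      using C L l False by (intro mult_mono) (auto simp: field_simps)
    finally show ?thesis using lo hi by simp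
  qed
  have "Limsup (at_right 0)
      (\<lambda>l. ereal ((value_fun f r \<gamma> (L + l) x a - value_fun f r \<gamma> L x a) / l)) \<le> ereal (C / L)"
    if L: "0 < L" for L x a
  proof (rule Limsup_bounded)
    \<comment> \<open>The bound holds for every positive \<open>l\<close> already, since the
      quotient is at most \<open>C / (L + l)\<close> and \<open>C\<close> is nonnegative; the upper
      limit inherits it.\<close>
    have "(value_fun f r \<gamma> (L + l) x a - value_fun f r \<gamma> L x a) / l \<le> C / L" if l: "0 < l" for l
    proof -
      have "(value_fun f r \<gamma> (L + l) x a - value_fun f r \<gamma> L x a) / l \<le> C * l / (L + l) / l"
        using upper[OF L l] l by (intro divide_right_mono) auto
      also have "\<dots> = C / (L + l)" using l by simp
      also have "\<dots> \<le> C / L" using C L l by (intro divide_left_mono) auto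
      finally show ?thesis .
    qed
    then show "\<forall>\<^sub>F l in at_right 0.
        ereal ((value_fun f r \<gamma> (L + l) x a - value_fun f r \<gamma> L x a) / l) \<le> ereal (C / L)"
      by (intro eventually_at_rightI[of 0 1]) auto
  qed
  with mono upper show ?thesis
    by (intro exI[of _ C]) (auto simp: algebra_simps)
qed

end
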